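(* Let $a<b$ be real numbers and let $\rho:[a,b]\to\mathbb{R}$ be a continuous function. (i) If the integral $I(a,x)$ of $\rho$ over $[a,x]$ exists for every $x\in[a,b]$, then $\frac{d}{dx}I(a,x)=\rho(x)$ for all $x\in(a,b)$. (ii) If the integral $I(a,b)$ of $\rho$ over $[a,b]$ exists and $R$ is an antiderivative of $\rho$ on $[a,b]$, then $I(a,b)=R(b)-R(a)$.
   Context: The integral is defined axiomatically. For $\alpha<\beta$ in $[a,b]$, the integral of $\rho$ over $[\alpha,\beta]$ is said to exist if there is a function $I:[\alpha,\beta]\times[\alpha,\beta]\to\mathbb{R}$ satisfying (A) $I(x,y)+I(y,z)=I(x,z)$ for all $x,y,z\in[\alpha,\beta]$, and (B) $I(x,x+h)=\rho(x)h+o(h)$ as $h\to0$ for all $x\in[\alpha,\beta]$, i.e. $\lim_{h\to0}\frac{I(x,x+h)-\rho(x)h}{h}=0$, where $h\ne0$ ranges over values with $x+h\in[\alpha,\beta]$ (one-sided limits at the endpoints). Such a function, if it exists, is unique, and the integral of $\rho$ over $[\alpha,\beta]$ is the number $I(\alpha,\beta)$, also written $\int_\alpha^\beta\rho(x)\,dx$. If $\alpha\le\alpha'<\beta'\le\beta$, the restriction of $I$ to $[\alpha',\beta']\times[\alpha',\beta']$ satisfies the same axioms there, so the notation $I(\alpha',\beta')$ is unambiguous; $I(a,a)=0$. An antiderivative of $\rho$ on $[a,b]$ is a function $R:[a,b]\to\mathbb{R}$ with $R'(x)=\rho(x)$ for all $x\in[a,b]$ (one-sided derivatives at the endpoints).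 *)

theory Defs
  imports Complex_Main
begin

(* Axioms (A) and (B).  The filter (at 0 within ...) lets h range over the
   nonzero increments with x + h in the interval, so the limit is one-sided
   at the endpoints. *)
definition satisfies_integral_axioms ::
    "(real \<Rightarrow> real) \<Rightarrow> real \<Rightarrow> real \<Rightarrow> (real \<Rightarrow> real \<Rightarrow> real) \<Rightarrow> bool" where
  "satisfies_integral_axioms \<rho> \<alpha> \<beta> I \<longleftrightarrow>
     (\<forall>x\<in>{\<alpha>..\<beta>}. \<forall>y\<in>{\<alpha>..\<beta>}. \<forall>z\<in>{\<alpha>..\<beta>}. I x y + I y z = I x z) \<and>
     (\<forall>x\<in>{\<alpha>..\<beta>}.
        ((\<lambda>h. (I x (x + h) - \<rho> x * h) / h) \<longlongrightarrow> 0) (at 0 within {h. x + h \<in> {\<alpha>..\<beta>}}))"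

definition integral_exists :: "(real \<Rightarrow> real) \<Rightarrow> real \<Rightarrow> real \<Rightarrow> bool" where
  "integral_exists \<rho> \<alpha> \<beta> \<longleftrightarrow> (\<exists>I. satisfies_integral_axioms \<rho> \<alpha> \<beta> I)"

(* The number I(alpha, beta), meaningful for alpha <= beta when the integral
   exists: I is then unique on the square (satisfies_integral_axioms_unique),
   although not as a total HOL function. For alpha = beta the axioms are
   satisfiable and give the value 0, which is the convention I(a, a) = 0. *)
definition integral_value :: "(real \<Rightarrow> real) \<Rightarrow> real \<Rightarrow> real \<Rightarrow> real" where
  "integral_value \<rho> \<alpha> \<beta> = (THE v. \<exists>I. satisfies_integral_axioms \<rho> \<alpha> \<beta> I \<and> v = I \<alpha> \<beta>)"

definition antiderivative_on ::
    "(real \<Rightarrow> real) \<Rightarrow> (real \<Rightarrow> real) \<Rightarrow> real \<Rightarrow> real \<Rightarrow> bool" where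
  "antiderivative_on R \<rho> a b \<longleftrightarrow>
     (\<forall>x\<in>{a..b}. (R has_real_derivative \<rho> x) (at x within {a..b}))"

lemma satisfies_integral_axioms_deriv:
  assumes "satisfies_integral_axioms \<rho> \<alpha> \<beta> I" "x \<in> {\<alpha>..\<beta>}"
  shows "(I \<alpha> has_real_derivative \<rho> x) (at x within {\<alpha>..\<beta>})"
proof -
  let ?F = "at x within {\<alpha>..\<beta>}"
  have A: "I p q + I q r = I p r"
    if "p \<in> {\<alpha>..\<beta>}" "q \<in> {\<alpha>..\<beta>}" "r \<in> {\<alpha>..\<beta>}" for p q r
    using assms(1) that unfolding satisfies_integral_axioms_def by blast
  have B: "((\<lambda>h. (I x (x + h) - \<rho> x * h) / h) \<longlongrightarrow> 0) (at 0 within {h. x + h \<in> {\<alpha>..\<beta>}})"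
    using assms unfolding satisfies_integral_axioms_def by blast
  have shift: "filterlim (\<lambda>y. y - x) (at 0 within {h. x + h \<in> {\<alpha>..\<beta>}}) ?F"
    unfolding filterlim_at
  proof
    show "\<forall>\<^sub>F y in ?F. y - x \<in> {h. x + h \<in> {\<alpha>..\<beta>}} \<and> y - x \<noteq> 0"
      by (simp add: eventually_at_filter)
    show "((\<lambda>y. y - x) \<longlongrightarrow> 0) ?F"
      using tendsto_diff[OF tendsto_ident_at tendsto_const[of x], of x "{\<alpha>..\<beta>}"] by simp
  qed
  have "((\<lambda>y. (I x y - \<rho> x * (y - x)) / (y - x)) \<longlongrightarrow> 0) ?F"
    using filterlim_compose[OF B shift] by simp
  from tendsto_add[OF this tendsto_const[of "\<rho> x"]]
  have "((\<lambda>y. (I x y - \<rho> x * (y - x)) / (y - x) + \<rho> x) \<longlongrightarrow> \<rho> x) ?F"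
    by simp
  moreover have "\<forall>\<^sub>F y in ?F. (I x y - \<rho> x * (y - x)) / (y - x) + \<rho> x = (I \<alpha> y - I \<alpha> x) / (y - x)"
    unfolding eventually_at_filter
  proof (intro always_eventually allI impI)
    fix y assume y: "y \<noteq> x" "y \<in> {\<alpha>..\<beta>}"
    have "I \<alpha> y - I \<alpha> x = I x y"
      using A[of \<alpha> x y] y assms(2) by auto
    then show "(I x y - \<rho> x * (y - x)) / (y - x) + \<rho> x = (I \<alpha> y - I \<alpha> x) / (y - x)"
      using y by (simp add: field_simps)
  qed
  ultimately show ?thesis
    unfolding has_field_derivative_iff by (simp add: tendsto_cong)
qed

lemma satisfies_integral_axioms_unique:
  assumes I: "satisfies_integral_axioms \<rho> \<alpha> \<beta> I" and J: "satisfies_integral_axioms \<rho> \<alpha> \<beta> J"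
    and x: "x \<in> {\<alpha>..\<beta>}" and y: "y \<in> {\<alpha>..\<beta>}"
  shows "I x y = J x y"
proof -
  have A: "K p q + K q r = K p r"
    if "satisfies_integral_axioms \<rho> \<alpha> \<beta> K" "p \<in> {\<alpha>..\<beta>}" "q \<in> {\<alpha>..\<beta>}" "r \<in> {\<alpha>..\<beta>}" for K p q r
    using that unfolding satisfies_integral_axioms_def by blast
  have \<alpha>: "\<alpha> \<in> {\<alpha>..\<beta>}" using x by auto
  have d: "((\<lambda>t. I \<alpha> t - J \<alpha> t) has_real_derivative 0) (at t within {\<alpha>..\<beta>})"
    if "t \<in> {\<alpha>..\<beta>}" for t
    using DERIV_diff[OF satisfies_integral_axioms_deriv[OF I that]
        satisfies_integral_axioms_deriv[OF J that]] by simp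
  have cont: "continuous_on {\<alpha>..\<beta>} (\<lambda>t. I \<alpha> t - J \<alpha> t)"
    by (rule DERIV_continuous_on) (rule d)
  have at: "((\<lambda>t. I \<alpha> t - J \<alpha> t) has_real_derivative 0) (at t)" if "\<alpha> < t" "t < \<beta>" for t
    using d[of t] that by (simp add: at_within_Icc_at)
  have z: "I \<alpha> t = J \<alpha> t" if t: "t \<in> {\<alpha>..\<beta>}" for t
  proof (cases "\<alpha> < \<beta>")
    case True
    then have "I \<alpha> t - J \<alpha> t = I \<alpha> \<alpha> - J \<alpha> \<alpha>"
      using DERIV_isconst2[OF True cont at, of t] t by simp
    then show ?thesis using A[OF I \<alpha> \<alpha> \<alpha>] A[OF J \<alpha> \<alpha> \<alpha>] by simp
  next
    case False
    then have "t = \<alpha>" using t by auto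
    then show ?thesis using A[OF I \<alpha> \<alpha> \<alpha>] A[OF J \<alpha> \<alpha> \<alpha>] by simp
  qed
  show ?thesis
    using A[OF I \<alpha> x y] A[OF J \<alpha> x y] z[OF x] z[OF y] by simp
qed

lemma integral_value_eq:
  assumes "satisfies_integral_axioms \<rho> \<alpha> \<beta> I" "\<alpha> \<le> \<beta>"
  shows "integral_value \<rho> \<alpha> \<beta> = I \<alpha> \<beta>"
  unfolding integral_value_def
proof (rule the_equality)
  show "\<exists>J. satisfies_integral_axioms \<rho> \<alpha> \<beta> J \<and> I \<alpha> \<beta> = J \<alpha> \<beta>"
    using assms(1) by blast
  show "v = I \<alpha> \<beta>" if "\<exists>J. satisfies_integral_axioms \<rho> \<alpha> \<beta> J \<and> v = J \<alpha> \<beta>" for v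
    using that satisfies_integral_axioms_unique[OF _ assms(1), of _ \<alpha> \<beta>] assms(2) by auto
qed

lemma satisfies_integral_axioms_degenerate:
  "satisfies_integral_axioms \<rho> \<alpha> \<alpha> (\<lambda>_ _. 0)"
proof -
  have "{h. \<alpha> + h \<in> {\<alpha>..\<alpha>}} = {0}" by auto
  moreover have "at (0::real) within {0} = bot"
    by (simp add: at_within_def)
  ultimately show ?thesis
    by (simp add: satisfies_integral_axioms_def)
qed

lemma integral_exists_degenerate: "integral_exists \<rho> \<alpha> \<alpha>"
  using satisfies_integral_axioms_degenerate unfolding integral_exists_def by blast

lemma integral_value_degenerate: "integral_value \<rho> \<alpha> \<alpha> = 0"
  using integral_value_eq[OF satisfies_integral_axioms_degenerate] by simp

end

theory Submission
  imports Defs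
begin

text \<open>By (A), \<open>I a y - I a x = I x y\<close>, so (B) says exactly that
  \<open>I a\<close> has derivative \<rho> on the interval
  (\<open>satisfies_integral_axioms_deriv\<close>). For (i), one \<open>I\<close> on the whole
  interval restricts to each initial segment, so by uniqueness
  \<open>integral_value \<rho> a\<close> coincides with \<open>I a\<close> and inherits its
  derivative. For (ii), \<open>I a\<close> and \<open>R\<close> are both antiderivatives, hence
  differ by a constant (\<open>antiderivative_on_diff_eq\<close>), and
  \<open>I a a = 0\<close>.\<close>

lemma satisfies_integral_axioms_subinterval:
  assumes "satisfies_integral_axioms \<rho> \<alpha> \<beta> I" "{\<alpha>'..\<beta>'} \<subseteq> {\<alpha>..\<beta>}"
  shows "satisfies_integral_axioms \<rho> \<alpha>' \<beta>' I"
  unfolding satisfies_integral_axioms_def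
proof (intro conjI ballI)
  show "I x y + I y z = I x z"
    if "x \<in> {\<alpha>'..\<beta>'}" "y \<in> {\<alpha>'..\<beta>'}" "z \<in> {\<alpha>'..\<beta>'}" for x y z
    using assms that unfolding satisfies_integral_axioms_def by blast
  fix x assume "x \<in> {\<alpha>'..\<beta>'}"
  then have "((\<lambda>h. (I x (x + h) - \<rho> x * h) / h) \<longlongrightarrow> 0) (at 0 within {h. x + h \<in> {\<alpha>..\<beta>}})"
    using assms unfolding satisfies_integral_axioms_def by blast
  then show "((\<lambda>h. (I x (x + h) - \<rho> x * h) / h) \<longlongrightarrow> 0) (at 0 within {h. x + h \<in> {\<alpha>'..\<beta>'}})"
    \<comment> \<open>A smaller interval admits fewer increments \<open>h\<close>, and a limit
      survives restriction to a subset, including the one-sided case at a new endpoint.\<close>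
    by (rule tendsto_within_subset) (use assms(2) in blast)
qed

text \<open>A priori each upper endpoint \<open>t\<close> brings its own function \<open>I\<close>.
  A single one for the whole interval serves them all, so differentiating the integral reduces to
  differentiating \<open>I a\<close>.\<close>

lemma integral_value_has_derivative:
  assumes "integral_exists \<rho> a b" "x \<in> {a<..<b}"
  shows "((\<lambda>t. integral_value \<rho> a t) has_real_derivative \<rho> x) (at x)"
proof -
  obtain I where I: "satisfies_integral_axioms \<rho> a b I"
    using assms(1) unfolding integral_exists_def by blast
  have "(I a has_real_derivative \<rho> x) (at x)"
    using satisfies_integral_axioms_deriv[OF I, of x] assms(2) by (simp add: at_within_Icc_at)
  \<comment> \<open>Agreement on an open neighbourhood of \<open>x\<close> is enough to transfer the
    derivative.\<close>
  moreover have "I a t = integral_value \<rho> a t" if "t \<in> {a<..<b}" for t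
    using integral_value_eq[OF satisfies_integral_axioms_subinterval[OF I, of a t]] that by auto
  ultimately show ?thesis
    using has_field_derivative_transform_within_open[OF _ open_greaterThanLessThan assms(2)]
    by blast
qed

text \<open>The difference \<open>F - G\<close> has derivative zero. The one-sided derivatives at
  the endpoints make it continuous on the closed interval, so its constancy extends from the
  interior to \<open>a\<close> and \<open>b\<close>.\<close>

lemma antiderivative_on_diff_eq:
  assumes "a < b" "antiderivative_on F \<rho> a b" "antiderivative_on G \<rho> a b"
  shows "F b - F a = G b - G a"
proof -
  have d: "((\<lambda>t. F t - G t) has_real_derivative 0) (at t within {a..b})" if "t \<in> {a..b}" for t
    using assms(2,3) that DERIV_diff[of F "\<rho> t" t "{a..b}" G "\<rho> t"]
    unfolding antiderivative_on_def by simp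
  have "continuous_on {a..b} (\<lambda>t. F t - G t)"
    by (rule DERIV_continuous_on) (rule d)
  moreover have "((\<lambda>t. F t - G t) has_real_derivative 0) (at t)" if "a < t" "t < b" for t
    using d[of t] that by (simp add: at_within_Icc_at)
  ultimately have "F b - G b = F a - G a"
    using DERIV_isconst2[OF assms(1), of "\<lambda>t. F t - G t" b] assms(1) by simp
  then show ?thesis by simp
qed

lemma integral_value_eq_antiderivative_diff:
  assumes "a < b" "integral_exists \<rho> a b" "antiderivative_on R \<rho> a b"
  shows "integral_value \<rho> a b = R b - R a"
proof -
  obtain I where I: "satisfies_integral_axioms \<rho> a b I"
    using assms(2) unfolding integral_exists_def by blast
  have "antiderivative_on (I a) \<rho> a b"
    using satisfies_integral_axioms_deriv[OF I] unfolding antiderivative_on_def by blast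
  then have "I a b - I a a = R b - R a"
    using antiderivative_on_diff_eq assms(1,3) by blast
  \<comment> \<open>Additivity with all three points equal to \<open>a\<close> forces
    \<open>I a a = 0\<close>.\<close>
  moreover have "I a a + I a a = I a a"
    using I assms(1) unfolding satisfies_integral_axioms_def by auto
  ultimately show ?thesis
    using integral_value_eq[OF I] assms(1) by simp
qed

theorem theorem3p1:
  fixes a b :: real and \<rho> :: "real \<Rightarrow> real"
  assumes "a < b" and "continuous_on {a..b} \<rho>"
  shows "((\<forall>x\<in>{a..b}. integral_exists \<rho> a x) \<longrightarrow>
            (\<forall>x\<in>{a<..<b}. ((\<lambda>t. integral_value \<rho> a t) has_real_derivative \<rho> x) (at x))) \<and>
         (\<forall>R. integral_exists \<rho> a b \<and> antiderivative_on R \<rho> a b \<longrightarrow>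
            integral_value \<rho> a b = R b - R a)"
proof (intro conjI impI allI ballI)
  show "((\<lambda>t. integral_value \<rho> a t) has_real_derivative \<rho> x) (at x)"
    if "\<forall>x\<in>{a..b}. integral_exists \<rho> a x" "x \<in> {a<..<b}" for x
    \<comment> \<open>Existence over the whole interval is the hypothesis at the upper endpoint
      \<open>b\<close>.\<close>
    using integral_value_has_derivative[of \<rho> a b x] that assms(1) by simp
  show "integral_value \<rho> a b = R b - R a"
    if "integral_exists \<rho> a b \<and> antiderivative_on R \<rho> a b" for R
    using integral_value_eq_antiderivative_diff assms(1) that by blast
qed

end
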